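(* Let $\mathcal U\subseteq\mathbb R^n$ be open, $R=C^\infty(\mathcal U)$ with a filtration $I_\bullet$ by ideals, and let $\widehat R=\widehat R^{(I_\bullet)}$. Let $\{l_k\}$ be a (possibly infinite) set of $\mathbb R$-linear functionals, each defined on $R$ or on a vector subspace of $R$, and let $\{c_k\}$ be real numbers. Then the conditions $\{(l_k,c_k)\}$ are $\widehat f$-resolvable for every $\widehat f\in\widehat R$ if and only if the conditions $\{(l_k,c_k)\}$ are resolvable and moreover the completion map restricts to a surjection $\bigcap_k\mathrm{Ker}(l_k)\twoheadrightarrow\widehat R$.
   Context: A filtration of $R$ is a decreasing sequence of ideals $R=I_0\supseteq I_1\supseteq\cdots$; $\widehat R^{(I_\bullet)}:=\varprojlim_jR/I_j$; $f\in R$ is a representative of $\widehat f\in\widehat R$ if the completion map $R\to\widehat R$ sends $f$ to $\widehat f$. The functionals $l_k$ are not assumed continuous in any sense; $\mathrm{Ker}(l_k)$ is the kernel inside the domain of $l_k$. The conditions $\{(l_k,c_k)\}$ are resolvable if there exists $f\in R$ (in the domain of all $l_k$) satisfying $l_k(f)=c_k$ for all $k$. They are $\widehat f$-resolvable if there exists a representative $f\in R$ of $\widehat f$ that satisfies $l_k(f)=c_k$ for all $k$. *)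

theory Defs
  imports "HOL-Analysis.Analysis" "HOL-Algebra.QuotRing"
begin

section \<open>The ring of smooth functions on an open set\<close>

text \<open>These are meant for open sets only: all derivatives are full derivatives at the point,
  so on an open set they do not depend on the values outside of it.\<close>

primrec Ck_on :: "nat \<Rightarrow> 'a::real_normed_vector set \<Rightarrow> ('a \<Rightarrow> real) \<Rightarrow> bool" where
  "Ck_on 0 U f \<longleftrightarrow> continuous_on U f"
| "Ck_on (Suc k) U f \<longleftrightarrow> (\<forall>x\<in>U. f differentiable (at x)) \<and>
     (\<forall>v. Ck_on k U (\<lambda>x. frechet_derivative f (at x) v))"

definition smooth_on :: "'a::real_normed_vector set \<Rightarrow> ('a \<Rightarrow> real) \<Rightarrow> bool" where
  "smooth_on U f \<longleftrightarrow> (\<forall>k. Ck_on k U f)"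

text \<open>A function \<open>U \<rightarrow> \<real>\<close> is encoded as an extensional function (\<open>undefined\<close> outside \<open>U\<close>), so that
  equality of elements of the ring is equality of functions on \<open>U\<close>.\<close>

definition smooth_ring :: "'a::real_normed_vector set \<Rightarrow> ('a \<Rightarrow> real) ring" where
  "smooth_ring U =
    \<lparr>carrier = {f \<in> extensional U. smooth_on U f},
     mult = (\<lambda>f g. \<lambda>x\<in>U. f x * g x),
     one = (\<lambda>x\<in>U. 1),
     zero = (\<lambda>x\<in>U. 0),
     add = (\<lambda>f g. \<lambda>x\<in>U. f x + g x)\<rparr>"

definition smooth_scale :: "'a set \<Rightarrow> real \<Rightarrow> ('a \<Rightarrow> real) \<Rightarrow> ('a \<Rightarrow> real)" where
  "smooth_scale U a f = (\<lambda>x\<in>U. a * f x)"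


section \<open>Filtrations and completions\<close>

definition ring_filtration :: "('r, 'm) ring_scheme \<Rightarrow> (nat \<Rightarrow> 'r set) \<Rightarrow> bool" where
  "ring_filtration R I \<longleftrightarrow> (\<forall>j. ideal (I j) R) \<and> I 0 = carrier R \<and> (\<forall>j. I (Suc j) \<subseteq> I j)"

text \<open>The canonical map from \<open>R / I i\<close> to \<open>R / I j\<close> for \<open>j \<le> i\<close>; see \<open>transition_map_coset\<close>.\<close>

definition transition_map ::
    "('r, 'm) ring_scheme \<Rightarrow> (nat \<Rightarrow> 'r set) \<Rightarrow> nat \<Rightarrow> 'r set \<Rightarrow> 'r set" where
  "transition_map R I j C = I j <+>\<^bsub>R\<^esub> C"

definition ring_completion :: "('r, 'm) ring_scheme \<Rightarrow> (nat \<Rightarrow> 'r set) \<Rightarrow> (nat \<Rightarrow> 'r set) ring" where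
  "ring_completion R I =
    \<lparr>carrier = {x. (\<forall>j. x j \<in> carrier (R Quot I j)) \<and>
                   (\<forall>i j. j \<le> i \<longrightarrow> transition_map R I j (x i) = x j)},
     mult = (\<lambda>x y j. x j \<otimes>\<^bsub>R Quot I j\<^esub> y j),
     one = (\<lambda>j. \<one>\<^bsub>R Quot I j\<^esub>),
     zero = (\<lambda>j. \<zero>\<^bsub>R Quot I j\<^esub>),
     add = (\<lambda>x y j. x j \<oplus>\<^bsub>R Quot I j\<^esub> y j)\<rparr>"

definition completion_map :: "('r, 'm) ring_scheme \<Rightarrow> (nat \<Rightarrow> 'r set) \<Rightarrow> 'r \<Rightarrow> (nat \<Rightarrow> 'r set)" where
  "completion_map R I f = (\<lambda>j. I j +>\<^bsub>R\<^esub> f)"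

definition representative ::
    "('r, 'm) ring_scheme \<Rightarrow> (nat \<Rightarrow> 'r set) \<Rightarrow> (nat \<Rightarrow> 'r set) \<Rightarrow> 'r \<Rightarrow> bool" where
  "representative R I fh f \<longleftrightarrow> f \<in> carrier R \<and> completion_map R I f = fh"


section \<open>Partially defined linear functionals and resolvability\<close>

definition smooth_subspace :: "'a::real_normed_vector set \<Rightarrow> ('a \<Rightarrow> real) set \<Rightarrow> bool" where
  "smooth_subspace U D \<longleftrightarrow> D \<subseteq> carrier (smooth_ring U) \<and> \<zero>\<^bsub>smooth_ring U\<^esub> \<in> D \<and>
     (\<forall>f\<in>D. \<forall>g\<in>D. f \<oplus>\<^bsub>smooth_ring U\<^esub> g \<in> D) \<and>
     (\<forall>a. \<forall>f\<in>D. smooth_scale U a f \<in> D)"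

text \<open>A functional is a pair of a domain \<open>D\<close> and a map \<open>l\<close>; values of \<open>l\<close> outside \<open>D\<close> are
  irrelevant.\<close>

definition linear_functional_on ::
    "'a::real_normed_vector set \<Rightarrow> ('a \<Rightarrow> real) set \<Rightarrow> (('a \<Rightarrow> real) \<Rightarrow> real) \<Rightarrow> bool" where
  "linear_functional_on U D l \<longleftrightarrow> smooth_subspace U D \<and>
     (\<forall>f\<in>D. \<forall>g\<in>D. l (f \<oplus>\<^bsub>smooth_ring U\<^esub> g) = l f + l g) \<and>
     (\<forall>a. \<forall>f\<in>D. l (smooth_scale U a f) = a * l f)"

definition Ker :: "('a \<Rightarrow> real) set \<Rightarrow> (('a \<Rightarrow> real) \<Rightarrow> real) \<Rightarrow> ('a \<Rightarrow> real) set" where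
  "Ker D l = {f \<in> D. l f = 0}"

definition satisfies_conditions ::
    "'k set \<Rightarrow> ('k \<Rightarrow> ('a \<Rightarrow> real) set) \<Rightarrow> ('k \<Rightarrow> ('a \<Rightarrow> real) \<Rightarrow> real) \<Rightarrow> ('k \<Rightarrow> real)
      \<Rightarrow> ('a \<Rightarrow> real) \<Rightarrow> bool" where
  "satisfies_conditions K D l c f \<longleftrightarrow> (\<forall>k\<in>K. f \<in> D k \<and> l k f = c k)"

definition resolvable ::
    "'a::real_normed_vector set \<Rightarrow> 'k set \<Rightarrow> ('k \<Rightarrow> ('a \<Rightarrow> real) set)
      \<Rightarrow> ('k \<Rightarrow> ('a \<Rightarrow> real) \<Rightarrow> real) \<Rightarrow> ('k \<Rightarrow> real) \<Rightarrow> bool" where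
  "resolvable U K D l c \<longleftrightarrow> (\<exists>f\<in>carrier (smooth_ring U). satisfies_conditions K D l c f)"

definition resolvable_at ::
    "'a::real_normed_vector set \<Rightarrow> (nat \<Rightarrow> ('a \<Rightarrow> real) set) \<Rightarrow> 'k set
      \<Rightarrow> ('k \<Rightarrow> ('a \<Rightarrow> real) set) \<Rightarrow> ('k \<Rightarrow> ('a \<Rightarrow> real) \<Rightarrow> real) \<Rightarrow> ('k \<Rightarrow> real)
      \<Rightarrow> (nat \<Rightarrow> ('a \<Rightarrow> real) set) \<Rightarrow> bool" where
  "resolvable_at U I K D l c fh \<longleftrightarrow>
     (\<exists>f. representative (smooth_ring U) I fh f \<and> satisfies_conditions K D l c f)"

text \<open>The intersection is taken inside the ring, so that it is the whole ring if there are no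
  functionals.\<close>

definition common_kernel ::
    "'a::real_normed_vector set \<Rightarrow> 'k set \<Rightarrow> ('k \<Rightarrow> ('a \<Rightarrow> real) set)
      \<Rightarrow> ('k \<Rightarrow> ('a \<Rightarrow> real) \<Rightarrow> real) \<Rightarrow> ('a \<Rightarrow> real) set" where
  "common_kernel U K D l = carrier (smooth_ring U) \<inter> (\<Inter>k\<in>K. Ker (D k) (l k))"


section \<open>Basic facts\<close>

lemma Ck_on_cong:
  assumes "open U" and "\<And>x. x \<in> U \<Longrightarrow> f x = g x" and "Ck_on k U f"
  shows "Ck_on k U g"
  using assms(2,3)
proof (induction k arbitrary: f g)
  case 0
  then show ?case using continuous_on_cong[of U U f g] by simp
next
  case (Suc k)
  have d: "frechet_derivative f (at x) = frechet_derivative g (at x)" "g differentiable (at x)"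
    if "x \<in> U" for x
  proof -
    have f: "f differentiable (at x)" using Suc.prems that by simp
    then show "frechet_derivative f (at x) = frechet_derivative g (at x)"
      using frechet_derivative_transform_within_open[OF f \<open>open U\<close> that] Suc.prems by blast
    show "g differentiable (at x)"
      using f has_derivative_transform_within_open[OF _ \<open>open U\<close> that, of f _ UNIV g] Suc.prems(1)
      unfolding differentiable_def by blast
  qed
  have "Ck_on k U (\<lambda>x. frechet_derivative g (at x) v)" for v
    using Suc.IH[of "\<lambda>x. frechet_derivative f (at x) v" "\<lambda>x. frechet_derivative g (at x) v"]
      Suc.prems(2) d by simp
  then show ?case using d by simp
qed

lemma Ck_on_const: "Ck_on k U (\<lambda>_. a)"
proof (induction k arbitrary: a)
  case (Suc k)
  have "frechet_derivative (\<lambda>_. a) (at x) = (\<lambda>_. 0)" for x :: 'a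
    using frechet_derivative_at[OF has_derivative_const] by metis
  then show ?case using Suc by simp
qed simp

lemma Ck_on_add:
  assumes "open U" "Ck_on k U f" "Ck_on k U g"
  shows "Ck_on k U (\<lambda>x. f x + g x)"
  using assms(2,3)
proof (induction k arbitrary: f g)
  case 0
  then show ?case by (simp add: continuous_on_add)
next
  case (Suc k)
  have d: "frechet_derivative f (at x) v + frechet_derivative g (at x) v
      = frechet_derivative (\<lambda>x. f x + g x) (at x) v" if "x \<in> U" for x v
  proof -
    have "((\<lambda>x. f x + g x) has_derivative
        (\<lambda>v. frechet_derivative f (at x) v + frechet_derivative g (at x) v)) (at x)"
      using Suc.prems that by (intro has_derivative_add) (auto simp: frechet_derivative_works)
    from frechet_derivative_at[OF this] show ?thesis by metis
  qed
  have "Ck_on k U (\<lambda>x. frechet_derivative (\<lambda>x. f x + g x) (at x) v)" for v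
    using Suc.prems by (intro Ck_on_cong[OF \<open>open U\<close> d Suc.IH]) auto
  then show ?case using Suc.prems by simp
qed

lemma Ck_on_Suc_imp: "Ck_on (Suc k) U f \<Longrightarrow> Ck_on k U f"
proof (induction k arbitrary: f)
  case 0
  then show ?case
    by (auto intro!: differentiable_imp_continuous_on
        simp: differentiable_on_def differentiable_at_withinI)
next
  case (Suc k)
  then show ?case by (metis Ck_on.simps(2))
qed

lemma Ck_on_mult:
  assumes "open U" "Ck_on k U f" "Ck_on k U g"
  shows "Ck_on k U (\<lambda>x. f x * g x)"
  using assms(2,3)
proof (induction k arbitrary: f g)
  case 0
  then show ?case by (simp add: continuous_on_mult)
next
  case (Suc k)
  have d: "f x * frechet_derivative g (at x) v + frechet_derivative f (at x) v * g x
      = frechet_derivative (\<lambda>x. f x * g x) (at x) v" if "x \<in> U" for x v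
  proof -
    have "((\<lambda>x. f x * g x) has_derivative
        (\<lambda>v. f x * frechet_derivative g (at x) v + frechet_derivative f (at x) v * g x)) (at x)"
      using Suc.prems that by (intro has_derivative_mult) (auto simp: frechet_derivative_works)
    from frechet_derivative_at[OF this] show ?thesis by metis
  qed
  have "Ck_on k U (\<lambda>x. frechet_derivative (\<lambda>x. f x * g x) (at x) v)" for v
    using Suc.prems Ck_on_Suc_imp
    by (intro Ck_on_cong[OF \<open>open U\<close> d Ck_on_add] Suc.IH \<open>open U\<close>) auto
  then show ?case using Suc.prems by simp
qed

lemma smooth_on_cong:
  "open U \<Longrightarrow> (\<And>x. x \<in> U \<Longrightarrow> f x = g x) \<Longrightarrow> smooth_on U f \<Longrightarrow> smooth_on U g"
  unfolding smooth_on_def using Ck_on_cong by blast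

lemma smooth_on_restrict: "open U \<Longrightarrow> smooth_on U f \<Longrightarrow> smooth_on U (restrict f U)"
  by (erule smooth_on_cong) auto

lemma cring_smooth_ring:
  assumes "open U"
  shows "cring (smooth_ring U)"
proof (rule cringI)
  show "abelian_group (smooth_ring U)"
  proof (rule abelian_groupI)
    fix f assume f: "f \<in> carrier (smooth_ring U)"
    have "smooth_on U (\<lambda>x. (-1) * f x)"
      using f Ck_on_mult[OF assms Ck_on_const, of _ f "-1"]
      by (simp add: smooth_ring_def smooth_on_def)
    then have "(\<lambda>x\<in>U. (-1) * f x) \<in> carrier (smooth_ring U)"
      using smooth_on_restrict[OF assms] by (simp add: smooth_ring_def)
    then show "\<exists>g\<in>carrier (smooth_ring U). g \<oplus>\<^bsub>smooth_ring U\<^esub> f = \<zero>\<^bsub>smooth_ring U\<^esub>"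
      by (rule bexI[rotated]) (auto simp: smooth_ring_def)
  qed (use assms in \<open>auto simp: smooth_ring_def fun_eq_iff extensional_def Ck_on_add Ck_on_const
        smooth_on_def intro!: smooth_on_restrict[unfolded smooth_on_def, rule_format]\<close>)
  show "comm_monoid (smooth_ring U)"
    using assms by unfold_locales
      (auto simp: smooth_ring_def fun_eq_iff extensional_def Ck_on_mult Ck_on_const
        smooth_on_def intro!: smooth_on_restrict[unfolded smooth_on_def, rule_format])
qed (auto simp: smooth_ring_def fun_eq_iff algebra_simps)

lemma ring_filtration_mono:
  assumes "ring_filtration R I" "j \<le> i"
  shows "I i \<subseteq> I j"
  using assms lift_Suc_antimono_le[of I] by (simp add: ring_filtration_def)

lemma transition_map_coset:
  assumes "ring_filtration R I" "j \<le> i" "f \<in> carrier R"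
  shows "transition_map R I j (I i +>\<^bsub>R\<^esub> f) = I j +>\<^bsub>R\<^esub> f"
proof -
  interpret J: ideal "I j" R using assms(1) by (simp add: ring_filtration_def)
  interpret I: ideal "I i" R using assms(1) by (simp add: ring_filtration_def)
  have sub: "I i \<subseteq> I j" using ring_filtration_mono[OF assms(1,2)] .
  show ?thesis
  proof (intro equalityI subsetI)
    fix z assume "z \<in> transition_map R I j (I i +>\<^bsub>R\<^esub> f)"
    then obtain a b where ab: "a \<in> I j" "b \<in> I i" "z = a \<oplus>\<^bsub>R\<^esub> (b \<oplus>\<^bsub>R\<^esub> f)"
      by (auto simp: transition_map_def set_add_def' a_r_coset_def')
    then have "z = (a \<oplus>\<^bsub>R\<^esub> b) \<oplus>\<^bsub>R\<^esub> f"
      using assms(3) by (simp add: J.a_assoc)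
    moreover have "a \<oplus>\<^bsub>R\<^esub> b \<in> I j" using ab sub by auto
    ultimately show "z \<in> I j +>\<^bsub>R\<^esub> f" by (auto simp: a_r_coset_def')
  next
    fix z assume "z \<in> I j +>\<^bsub>R\<^esub> f"
    then obtain a where a: "a \<in> I j" "z = a \<oplus>\<^bsub>R\<^esub> f" by (auto simp: a_r_coset_def')
    then have "z = a \<oplus>\<^bsub>R\<^esub> (\<zero>\<^bsub>R\<^esub> \<oplus>\<^bsub>R\<^esub> f)" using assms(3) by simp
    then show "z \<in> transition_map R I j (I i +>\<^bsub>R\<^esub> f)"
      using a(1) I.zero_closed unfolding transition_map_def set_add_def' a_r_coset_def' by blast
  qed
qed

lemma completion_map_ring_hom:
  assumes "ring_filtration R I"
  shows "completion_map R I \<in> ring_hom R (ring_completion R I)"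
proof -
  have h: "(+>\<^bsub>R\<^esub>) (I j) \<in> ring_hom R (R Quot I j)" for j
    using assms by (intro ideal.rcos_ring_hom) (simp add: ring_filtration_def)
  show ?thesis
    using transition_map_coset[OF assms] ring_hom_memE[OF h]
    by (intro ring_hom_memI) (auto simp: ring_completion_def completion_map_def)
qed

end

theory Submission
  imports Defs
begin

text \<open>The completion map \<open>\<phi>\<close> is additive, and the solutions of the conditions are closed under
  translation by the common kernel. If every element of the completion is resolvable and \<open>f\<close>
  resolves the conditions, then a solution \<open>g\<close> representing \<open>\<phi> (2 f)\<close> gives \<open>g - f\<close> in the common
  kernel with \<open>\<phi> (g - f) = \<phi> f\<close>. Conversely, a solution \<open>f\<^sub>0\<close> is moved to a solution
  representing \<open>\<phi> h\<close> by adding an element \<open>g\<close> of the common kernel with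
  \<open>\<phi> g = \<phi> (h - f\<^sub>0)\<close>.\<close>

text \<open>\<open>linear_functional_on\<close> speaks of sums and scalings only. Uniqueness of
  additive inverses identifies the ring negative of \<open>g\<close> with its scaling by
  \<open>-1\<close>, which brings differences within reach.\<close>

lemma linear_functional_on_minus:
  assumes "open U" "linear_functional_on U D l" "f \<in> D" "g \<in> D"
  shows "f \<ominus>\<^bsub>smooth_ring U\<^esub> g \<in> D" and "l (f \<ominus>\<^bsub>smooth_ring U\<^esub> g) = l f - l g"
proof -
  let ?R = "smooth_ring U"
  interpret cring ?R using assms(1) by (rule cring_smooth_ring)
  have D: "smooth_scale U (-1) g \<in> D" "D \<subseteq> carrier ?R"
    using assms by (auto simp: linear_functional_on_def smooth_subspace_def)
  have "smooth_scale U (-1) g \<oplus>\<^bsub>?R\<^esub> g = \<zero>\<^bsub>?R\<^esub>"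
    by (auto simp: smooth_scale_def smooth_ring_def fun_eq_iff)
  then have "\<ominus>\<^bsub>?R\<^esub> g = smooth_scale U (-1) g"
    using D assms(4) by (intro minus_equality) auto
  then have "f \<ominus>\<^bsub>?R\<^esub> g = f \<oplus>\<^bsub>?R\<^esub> smooth_scale U (-1) g"
    by (simp add: a_minus_def)
  then show "f \<ominus>\<^bsub>?R\<^esub> g \<in> D" "l (f \<ominus>\<^bsub>?R\<^esub> g) = l f - l g"
    using assms D(1) by (auto simp: linear_functional_on_def smooth_subspace_def)
qed

text \<open>The common values \<open>c k\<close> cancel under each \<open>l k\<close>. Carrier
  membership is assumed separately because for empty \<open>K\<close> the conditions give
  none.\<close>

lemma satisfies_conditions_minus:
  assumes "open U" "\<And>k. k \<in> K \<Longrightarrow> linear_functional_on U (D k) (l k)"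
    and "f \<in> carrier (smooth_ring U)" "g \<in> carrier (smooth_ring U)"
    and "satisfies_conditions K D l c f" "satisfies_conditions K D l c g"
  shows "f \<ominus>\<^bsub>smooth_ring U\<^esub> g \<in> common_kernel U K D l"
proof -
  interpret cring "smooth_ring U" using assms(1) by (rule cring_smooth_ring)
  show ?thesis
    using assms linear_functional_on_minus[OF assms(1,2)]
    by (auto simp: common_kernel_def Ker_def satisfies_conditions_def)
qed

lemma satisfies_conditions_add:
  assumes "\<And>k. k \<in> K \<Longrightarrow> linear_functional_on U (D k) (l k)"
    and "g \<in> common_kernel U K D l" "satisfies_conditions K D l c f"
  shows "satisfies_conditions K D l c (g \<oplus>\<^bsub>smooth_ring U\<^esub> f)"
  using assms
  by (fastforce simp: common_kernel_def Ker_def satisfies_conditions_def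
      linear_functional_on_def smooth_subspace_def)

theorem lemma6p5:
  fixes U :: "(real ^ 'n) set"
    and I :: "nat \<Rightarrow> (real ^ 'n \<Rightarrow> real) set"
    and K :: "'k set"
    and D :: "'k \<Rightarrow> (real ^ 'n \<Rightarrow> real) set"
    and l :: "'k \<Rightarrow> (real ^ 'n \<Rightarrow> real) \<Rightarrow> real"
    and c :: "'k \<Rightarrow> real"
  assumes "open U"
    and "ring_filtration (smooth_ring U) I"
    and "\<And>k. k \<in> K \<Longrightarrow> linear_functional_on U (D k) (l k)"
  shows "(\<forall>fh \<in> carrier (ring_completion (smooth_ring U) I). resolvable_at U I K D l c fh) \<longleftrightarrow>
    (resolvable U K D l c \<and>
     completion_map (smooth_ring U) I ` common_kernel U K D l = carrier (ring_completion (smooth_ring U) I))"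
proof -
  let ?R = "smooth_ring U" and ?S = "ring_completion (smooth_ring U) I"
  let ?\<phi> = "completion_map ?R I" and ?N = "common_kernel U K D l"
  interpret cring ?R using assms(1) by (rule cring_smooth_ring)
  have hom: "?\<phi> \<in> ring_hom ?R ?S" using assms(2) by (rule completion_map_ring_hom)
  note add = ring_hom_add[OF hom] and closed = ring_hom_closed[OF hom]
  have N: "?N \<subseteq> carrier ?R" by (auto simp: common_kernel_def)
  show ?thesis
  proof (intro iffI conjI)
    assume L: "\<forall>fh\<in>carrier ?S. resolvable_at U I K D l c fh"
    \<comment> \<open>One element of the completion is enough; the image of zero provides
      it.\<close>
    show "resolvable U K D l c"
      using L closed[OF zero_closed] unfolding resolvable_at_def resolvable_def representative_def
      by blast
    show "?\<phi> ` ?N = carrier ?S"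
    proof (intro equalityI subsetI)
      fix fh assume "fh \<in> carrier ?S"
      with L obtain f where f: "f \<in> carrier ?R" "?\<phi> f = fh" "satisfies_conditions K D l c f"
        unfolding resolvable_at_def representative_def by blast
      \<comment> \<open>Doubling inside \<open>?R\<close> keeps the target in the image of
        \<open>?\<phi>\<close>, so its membership in \<open>?S\<close> needs no closure of
        \<open>?S\<close> under addition.\<close>
      moreover have "?\<phi> (f \<oplus>\<^bsub>?R\<^esub> f) \<in> carrier ?S" using f by (intro closed) simp
      ultimately obtain g where g: "g \<in> carrier ?R" "?\<phi> g = ?\<phi> (f \<oplus>\<^bsub>?R\<^esub> f)"
          "satisfies_conditions K D l c g"
        using L unfolding resolvable_at_def representative_def by blast
      \<comment> \<open>Additivity splits off the same summand, the image of the negative of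
        \<open>f\<close>, on both sides.\<close>
      have "?\<phi> (g \<ominus>\<^bsub>?R\<^esub> f) = ?\<phi> ((f \<oplus>\<^bsub>?R\<^esub> f) \<ominus>\<^bsub>?R\<^esub> f)"
        using f g by (simp add: a_minus_def add)
      also have "(f \<oplus>\<^bsub>?R\<^esub> f) \<ominus>\<^bsub>?R\<^esub> f = f"
        using f by (simp add: a_minus_def a_assoc r_neg)
      moreover have "g \<ominus>\<^bsub>?R\<^esub> f \<in> ?N"
        using assms(1,3) f g by (intro satisfies_conditions_minus) auto
      ultimately show "fh \<in> ?\<phi> ` ?N" using f(2) by (metis imageI)
    qed (use N closed in auto)
  next
    assume R: "resolvable U K D l c \<and> ?\<phi> ` ?N = carrier ?S"
    then obtain f0 where f0: "f0 \<in> carrier ?R" "satisfies_conditions K D l c f0"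
      unfolding resolvable_def by blast
    show "\<forall>fh\<in>carrier ?S. resolvable_at U I K D l c fh"
    proof
      fix fh assume "fh \<in> carrier ?S"
      \<comment> \<open>Surjectivity is used twice: first to lift \<open>fh\<close> to
        \<open>h\<close>, so that \<open>f0\<close> can be subtracted in \<open>?R\<close>, then to
        replace the difference by an element of \<open>?N\<close> with the same image.\<close>
      with R N obtain h where h: "h \<in> carrier ?R" "fh = ?\<phi> h" by blast
      then have "?\<phi> (h \<ominus>\<^bsub>?R\<^esub> f0) \<in> carrier ?S" using f0 by (intro closed) simp
      with R obtain g where g: "g \<in> ?N" "?\<phi> g = ?\<phi> (h \<ominus>\<^bsub>?R\<^esub> f0)" by (metis imageE)
      have "?\<phi> (g \<oplus>\<^bsub>?R\<^esub> f0) = ?\<phi> ((h \<ominus>\<^bsub>?R\<^esub> f0) \<oplus>\<^bsub>?R\<^esub> f0)"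
        using f0 g h N by (simp add: add subset_iff)
      also have "(h \<ominus>\<^bsub>?R\<^esub> f0) \<oplus>\<^bsub>?R\<^esub> f0 = h"
        using f0 h by (simp add: a_minus_def a_assoc l_neg)
      finally have "representative ?R I fh (g \<oplus>\<^bsub>?R\<^esub> f0)"
        using f0 g h N by (auto simp: representative_def)
      then show "resolvable_at U I K D l c fh"
        using satisfies_conditions_add[OF assms(3) g(1) f0(2)] unfolding resolvable_at_def by blast
    qed
  qed
qed

end
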